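(* Let $m,n>0$ be real numbers. Every harmonic map from a compact orientable Riemannian manifold without boundary into the Riemannian manifold $(\mathrm{Sol}^3_{m,n},g)$, where $g=e^{-2mt}dx^2+e^{2nt}dy^2+dt^2$, is constant.
   Context: For real $m,n>0$, $\mathrm{Sol}^3_{m,n}$ is the semidirect product $\mathbb{R}^2\rtimes_U\mathbb{R}$ with $U(t)=\mathrm{diag}(e^{mt},e^{-nt})$; its underlying manifold is $\mathbb{R}^3$ with global coordinates $(x,y,t)$. It carries the left-invariant Riemannian metric $g=e^{-2mt}dx^2+e^{2nt}dy^2+dt^2$. A smooth map $\varphi:(M,g_M)\to(N,h)$ of Riemannian manifolds is harmonic if its tension field vanishes: $\tau(\varphi)=\operatorname{Tr}_{g_M}\nabla d\varphi=\sum_i\left[\nabla^\varphi_{e_i}d\varphi(e_i)-d\varphi(\nabla^M_{e_i}e_i)\right]=0$, where $\{e_i\}$ is a local orthonormal frame on $M$, $\nabla^M$ is the Levi-Civita connection of $M$ and $\nabla^\varphi$ is the pull-back connection on $\varphi^{-1}TN$.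
   Formalization: The compact orientable Riemannian manifold is assumed connected; without this the claim fails, since a map taking different constant values on two disjoint circles is harmonic but not constant. *)

theory Defs
  imports "HOL-Analysis.Analysis"
begin

(* C^k and C^infinity maps.  For open S in a finite-dimensional space, C^(k+1) means
   differentiable with all directional derivatives C^k.  Only ever used with open S. *)

primrec Ck_on :: "nat \<Rightarrow> 'a::euclidean_space set \<Rightarrow> ('a \<Rightarrow> 'b::real_normed_vector) \<Rightarrow> bool" where
  "Ck_on 0 S f \<longleftrightarrow> continuous_on S f"
| "Ck_on (Suc k) S f \<longleftrightarrow>
     (\<forall>x\<in>S. f differentiable (at x)) \<and> (\<forall>v. Ck_on k S (\<lambda>x. frechet_derivative f (at x) v))"

definition smooth_on :: "'a::euclidean_space set \<Rightarrow> ('a \<Rightarrow> 'b::real_normed_vector) \<Rightarrow> bool" where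
  "smooth_on S f \<longleftrightarrow> (\<forall>k. Ck_on k S f)"


(* A chart is a pair (U, psi); the values of psi outside U are irrelevant. *)

type_synonym ('a, 'n) chart = "'a set \<times> ('a \<Rightarrow> real ^ 'n)"

definition chart_on :: "'a topology \<Rightarrow> ('a, 'n::finite) chart \<Rightarrow> bool" where
  "chart_on X c \<longleftrightarrow> openin X (fst c) \<and> open (snd c ` fst c) \<and>
     homeomorphic_map (subtopology X (fst c)) (top_of_set (snd c ` fst c)) (snd c)"

definition chart_inv :: "('a, 'n::finite) chart \<Rightarrow> real ^ 'n \<Rightarrow> 'a" where
  "chart_inv c = inv_into (fst c) (snd c)"

definition overlap :: "('a, 'n::finite) chart \<Rightarrow> ('a, 'n) chart \<Rightarrow> (real ^ 'n) set" where
  "overlap c d = snd c ` (fst c \<inter> fst d)"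

definition transition :: "('a, 'n::finite) chart \<Rightarrow> ('a, 'n) chart \<Rightarrow> real ^ 'n \<Rightarrow> real ^ 'n" where
  "transition c d = snd d \<circ> chart_inv c"

definition smooth_atlas :: "'a topology \<Rightarrow> ('a, 'n::finite) chart set \<Rightarrow> bool" where
  "smooth_atlas X A \<longleftrightarrow> (\<forall>c\<in>A. chart_on X c) \<and> (\<Union>c\<in>A. fst c) = topspace X \<and>
     (\<forall>c\<in>A. \<forall>d\<in>A. smooth_on (overlap c d) (transition c d))"

definition oriented_atlas :: "('a, 'n::finite) chart set \<Rightarrow> bool" where
  "oriented_atlas A \<longleftrightarrow>
     (\<forall>c\<in>A. \<forall>d\<in>A. \<forall>x\<in>overlap c d. det (jacobian (transition c d) (at x)) > 0)"


(* The metric is given by its Gram matrices, one matrix field on the image of each chart,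
   related by the tensor transformation law.  Manifolds have no boundary, since charts map
   onto open subsets of real ^ 'n. *)

record ('a, 'n) riemannian =
  space_of :: "'a topology"
  atlas_of :: "('a, 'n) chart set"
  metric_of :: "('a, 'n) chart \<Rightarrow> real ^ 'n \<Rightarrow> real ^ 'n ^ 'n"

definition riemannian_manifold :: "('a, 'n::finite) riemannian \<Rightarrow> bool" where
  "riemannian_manifold M \<longleftrightarrow>
     Hausdorff_space (space_of M) \<and> second_countable (space_of M) \<and>
     smooth_atlas (space_of M) (atlas_of M) \<and>
     (\<forall>c\<in>atlas_of M. smooth_on (snd c ` fst c) (metric_of M c) \<and>
        (\<forall>x\<in>snd c ` fst c. transpose (metric_of M c x) = metric_of M c x \<and>
           (\<forall>v. v \<noteq> 0 \<longrightarrow> v \<bullet> (metric_of M c x *v v) > 0))) \<and>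
     (\<forall>c\<in>atlas_of M. \<forall>d\<in>atlas_of M. \<forall>x\<in>overlap c d.
        metric_of M c x =
          transpose (jacobian (transition c d) (at x)) ** metric_of M d (transition c d x)
            ** jacobian (transition c d) (at x))"

(* Orientability is a property of the smooth structure: some atlas equivalent to the given one
   is oriented. *)

definition orientable :: "('a, 'n::finite) riemannian \<Rightarrow> bool" where
  "orientable M \<longleftrightarrow>
     (\<exists>B. smooth_atlas (space_of M) B \<and> smooth_atlas (space_of M) (atlas_of M \<union> B) \<and>
          oriented_atlas B)"


(* The Levi-Civita connection in coordinates; g is the Gram matrix field of a metric. *)

definition partial :: "'n \<Rightarrow> (real ^ 'n::finite \<Rightarrow> 'b::real_normed_vector) \<Rightarrow> real ^ 'n \<Rightarrow> 'b" where
  "partial i f x = frechet_derivative f (at x) (axis i 1)"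

definition christoffel ::
    "(real ^ 'n::finite \<Rightarrow> real ^ 'n ^ 'n) \<Rightarrow> 'n \<Rightarrow> 'n \<Rightarrow> 'n \<Rightarrow> real ^ 'n \<Rightarrow> real" where
  "christoffel g k i j x = 1 / 2 * (\<Sum>l\<in>UNIV. matrix_inv (g x) $ k $ l *
     (partial i (\<lambda>z. g z $ j $ l) x + partial j (\<lambda>z. g z $ i $ l) x
        - partial l (\<lambda>z. g z $ i $ j) x))"

definition christoffel_form ::
    "(real ^ 'n::finite \<Rightarrow> real ^ 'n ^ 'n) \<Rightarrow> real ^ 'n \<Rightarrow> real ^ 'n \<Rightarrow> real ^ 'n \<Rightarrow> real ^ 'n" where
  "christoffel_form g x u v =
     (\<chi> k. \<Sum>i\<in>UNIV. \<Sum>j\<in>UNIV. christoffel g k i j x * u $ i * v $ j)"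

definition levi_civita ::
    "(real ^ 'n::finite \<Rightarrow> real ^ 'n ^ 'n) \<Rightarrow>
     (real ^ 'n \<Rightarrow> real ^ 'n) \<Rightarrow> (real ^ 'n \<Rightarrow> real ^ 'n) \<Rightarrow> real ^ 'n \<Rightarrow> real ^ 'n" where
  "levi_civita g X Y x = frechet_derivative Y (at x) (X x) + christoffel_form g x (X x) (Y x)"

(* Pull-back along f of the Levi-Civita connection of the target metric h: X is a vector field
   on the source, W a section along f, i.e. W z is a tangent vector at f z. *)

definition pullback_connection ::
    "(real ^ 'k::finite \<Rightarrow> real ^ 'k ^ 'k) \<Rightarrow> (real ^ 'n::finite \<Rightarrow> real ^ 'k) \<Rightarrow>
     (real ^ 'n \<Rightarrow> real ^ 'n) \<Rightarrow> (real ^ 'n \<Rightarrow> real ^ 'k) \<Rightarrow> real ^ 'n \<Rightarrow> real ^ 'k" where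
  "pullback_connection h f X W x =
     frechet_derivative W (at x) (X x) +
     christoffel_form h (f x) (frechet_derivative f (at x) (X x)) (W x)"

definition orthonormal_frame ::
    "(real ^ 'n::finite \<Rightarrow> real ^ 'n ^ 'n) \<Rightarrow> (real ^ 'n) set \<Rightarrow>
     ('n \<Rightarrow> real ^ 'n \<Rightarrow> real ^ 'n) \<Rightarrow> bool" where
  "orthonormal_frame g V E \<longleftrightarrow>
     (\<forall>i. smooth_on V (E i)) \<and>
     (\<forall>x\<in>V. \<forall>i j. E i x \<bullet> (g x *v E j x) = (if i = j then 1 else 0))"

definition tension ::
    "(real ^ 'n::finite \<Rightarrow> real ^ 'n ^ 'n) \<Rightarrow> (real ^ 'k::finite \<Rightarrow> real ^ 'k ^ 'k) \<Rightarrow>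
     (real ^ 'n \<Rightarrow> real ^ 'k) \<Rightarrow> ('n \<Rightarrow> real ^ 'n \<Rightarrow> real ^ 'n) \<Rightarrow> real ^ 'n \<Rightarrow> real ^ 'k" where
  "tension g h f E x =
     (\<Sum>i\<in>UNIV. pullback_connection h f (E i) (\<lambda>z. frechet_derivative f (at z) (E i z)) x
        - frechet_derivative f (at x) (levi_civita g (E i) (E i) x))"


definition local_rep ::
    "('a, 'n::finite) chart \<Rightarrow> ('b, 'k::finite) chart \<Rightarrow> ('a \<Rightarrow> 'b) \<Rightarrow> real ^ 'n \<Rightarrow> real ^ 'k" where
  "local_rep c d \<phi> = snd d \<circ> \<phi> \<circ> chart_inv c"

definition local_dom ::
    "('a, 'n::finite) chart \<Rightarrow> ('b, 'k::finite) chart \<Rightarrow> ('a \<Rightarrow> 'b) \<Rightarrow> (real ^ 'n) set" where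
  "local_dom c d \<phi> = snd c ` (fst c \<inter> \<phi> -` fst d)"

definition smooth_map ::
    "('a, 'n::finite) riemannian \<Rightarrow> ('b, 'k::finite) riemannian \<Rightarrow> ('a \<Rightarrow> 'b) \<Rightarrow> bool" where
  "smooth_map M N \<phi> \<longleftrightarrow>
     continuous_map (space_of M) (space_of N) \<phi> \<and>
     (\<forall>c\<in>atlas_of M. \<forall>d\<in>atlas_of N. smooth_on (local_dom c d \<phi>) (local_rep c d \<phi>))"

(* The tension field does not depend on the frame, and smooth local orthonormal frames exist
   near every point by Gram-Schmidt. *)

definition harmonic_map ::
    "('a, 'n::finite) riemannian \<Rightarrow> ('b, 'k::finite) riemannian \<Rightarrow> ('a \<Rightarrow> 'b) \<Rightarrow> bool" where
  "harmonic_map M N \<phi> \<longleftrightarrow>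
     smooth_map M N \<phi> \<and>
     (\<forall>c\<in>atlas_of M. \<forall>d\<in>atlas_of N. \<forall>V E.
        open V \<and> V \<subseteq> local_dom c d \<phi> \<and> orthonormal_frame (metric_of M c) V E \<longrightarrow>
        (\<forall>x\<in>V. tension (metric_of M c) (metric_of N d) (local_rep c d \<phi>) E x = 0))"


(* Coordinates x = p$1, y = p$2, t = p$3. *)

definition sol_metric :: "real \<Rightarrow> real \<Rightarrow> real ^ 3 \<Rightarrow> real ^ 3 ^ 3" where
  "sol_metric m n p = vector
     [vector [exp (- 2 * m * p $ 3), 0, 0],
      vector [0, exp (2 * n * p $ 3), 0],
      vector [0, 0, 1]]"

definition Sol3 :: "real \<Rightarrow> real \<Rightarrow> (real ^ 3, 3) riemannian" where
  "Sol3 m n = \<lparr>space_of = euclidean, atlas_of = {(UNIV, id)}, metric_of = (\<lambda>_. sol_metric m n)\<rparr>"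

lemma Ck_const: "Ck_on k S (\<lambda>x. c)"
  by (induction k arbitrary: c) auto

lemma smooth_on_id: "smooth_on S id"
proof -
  have "Ck_on k S id" for k
    by (cases k) (auto simp: id_def Ck_const frechet_derivative_ident)
  then show ?thesis by (simp add: smooth_on_def)
qed

lemma Ck_exp: "Ck_on k S (\<lambda>p::real^3. exp (a * p$3) *\<^sub>R A + exp (b * p$3) *\<^sub>R B + C)"
proof (induction k arbitrary: A B C)
  case 0 show ?case by (auto intro!: continuous_intros)
next
  case (Suc k)
  have D: "((\<lambda>p::real^3. exp (a * p$3) *\<^sub>R A + exp (b * p$3) *\<^sub>R B + C) has_derivative
     (\<lambda>v. exp (a * x$3) *\<^sub>R ((a * v$3) *\<^sub>R A) + exp (b * x$3) *\<^sub>R ((b * v$3) *\<^sub>R B) + 0)) (at x)" for x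
    by (auto intro!: derivative_eq_intros bounded_linear.has_derivative[OF bounded_linear_vec_nth] simp: mult_ac)
  show ?case
    unfolding Ck_on.simps frechet_derivative_at[OF D, symmetric]
  proof (intro conjI ballI allI)
    show "(\<lambda>p::real^3. exp (a * p$3) *\<^sub>R A + exp (b * p$3) *\<^sub>R B + C) differentiable (at x)" for x
      using D by (rule differentiableI)
  qed (rule Suc)
qed

lemma sol_metric_eq: "sol_metric m n = (\<lambda>p. exp ((-2*m) * p$3) *\<^sub>R vector [vector [1,0,0],0,0]
   + exp ((2*n) * p$3) *\<^sub>R vector [0, vector [0,1,0],0] + vector [0,0,vector [0,0,1]])"
  by (auto simp: fun_eq_iff vec_eq_iff sol_metric_def forall_3)

lemma riemannian_manifold_Sol3: "riemannian_manifold (Sol3 m n)"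
proof -
  have [simp]: "jacobian id (at x) = mat 1" for x :: "real^3"
    using matrix_id_mat_1 by (simp add: jacobian_def frechet_derivative_ident id_def)
  have tr: "transition (UNIV, id) (UNIV, id) = (id :: real^3 \<Rightarrow> real^3)"
    by (simp add: transition_def chart_inv_def)
  have s: "smooth_on UNIV (sol_metric m n)"
    unfolding smooth_on_def sol_metric_eq using Ck_exp by blast
  have sc: "second_countable (euclidean :: (real^3) topology)"
  proof -
    obtain B :: "(real^3) set set" where B: "countable B" "\<And>C. C \<in> B \<Longrightarrow> open C" "\<And>S. open S \<Longrightarrow> \<exists>U. U \<subseteq> B \<and> S = \<Union>U"
      using univ_second_countable by metis
    show ?thesis unfolding second_countable_def
      apply (rule exI[of _ B]) using B by (simp flip: open_openin) (metis Union_iff Sup_upper subsetD)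
  qed
  have pos: "v \<bullet> (sol_metric m n x *v v) > 0" if "v \<noteq> 0" for v x
  proof -
    have "v \<bullet> (sol_metric m n x *v v) = exp (-2*m*x$3) * (v$1)^2 + exp (2*n*x$3) * (v$2)^2 + (v$3)^2"
      by (simp add: inner_vec_def matrix_vector_mult_def sum_3 sol_metric_def power2_eq_square algebra_simps)
    moreover have "v$1 \<noteq> 0 \<or> v$2 \<noteq> 0 \<or> v$3 \<noteq> 0" using that by (auto simp: vec_eq_iff forall_3)
    ultimately show ?thesis by (auto simp: add_pos_nonneg add_nonneg_pos)
  qed
  have sym: "transpose (sol_metric m n x) = sol_metric m n x" for x
    by (auto simp: vec_eq_iff forall_3 sol_metric_def transpose_def)
  have at: "smooth_atlas euclidean {(UNIV, id :: real^3 \<Rightarrow> real^3)}"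
    by (simp add: smooth_atlas_def chart_on_def tr smooth_on_id homeomorphic_map_id)
  show ?thesis
    by (simp add: riemannian_manifold_def Sol3_def sc at s sym pos tr transpose_mat Hausdorff_space_euclidean)
qed

end

theory Submission
  imports Defs
begin

text \<open>In the coordinates \<open>(x, y, t)\<close> of the target, harmonicity says that
  \<open>\<Delta> x = 2 m \<langle>\<nabla> x, \<nabla> t\<rangle>\<close>, \<open>\<Delta> y = - 2 n \<langle>\<nabla> y, \<nabla> t\<rangle>\<close> and
  \<open>\<Delta> t = n exp (2 n t) \<bar>\<nabla> y\<bar>\<^sup>2 - m exp (- 2 m t) \<bar>\<nabla> x\<bar>\<^sup>2\<close>.
  The first two equations are linear elliptic in \<open>x\<close> and in \<open>y\<close>, without a term of order zero, so
  by the strong maximum principle \<open>x\<close> and \<open>y\<close> are constant. Then \<open>t\<close> is a harmonic function, hence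
  constant as well.\<close>

section \<open>Calculus of smooth functions\<close>

text \<open>Derivatives in \<open>Ck_on\<close> are taken over full neighbourhoods; for open
  \<open>S\<close> these shrink into \<open>S\<close>, so values off \<open>S\<close> never
  enter.\<close>

lemma Ck_on_cong:
  assumes "open S" "\<And>x. x \<in> S \<Longrightarrow> f x = g x" "Ck_on k S f"
  shows "Ck_on k S g"
  using assms(2,3)
proof (induction k arbitrary: f g)
  case 0
  then show ?case by (metis Ck_on.simps(1) continuous_on_cong)
next
  case (Suc k)
  have D: "(g has_derivative frechet_derivative f (at x)) (at x)" if "x \<in> S" for x
    using Suc.prems that assms(1)
    by (intro has_derivative_transform_within_open[of f _ x UNIV S g])
      (auto simp: frechet_derivative_works)
  then have e: "frechet_derivative g (at x) = frechet_derivative f (at x)" if "x \<in> S" for x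
    using that by (simp add: frechet_derivative_at[symmetric])
  show ?case
    unfolding Ck_on.simps
  proof (intro conjI ballI allI)
    show "g differentiable at x" if "x \<in> S" for x
      using D[OF that] by (rule differentiableI)
    show "Ck_on k S (\<lambda>x. frechet_derivative g (at x) v)" for v
      by (rule Suc.IH[of "\<lambda>x. frechet_derivative f (at x) v"]) (use Suc.prems(2) in \<open>auto simp: e\<close>)
  qed
qed

text \<open>Lets a smoothness proof exhibit an explicit derivative \<open>f'\<close> and recurse on
  it, in place of computing with \<open>frechet_derivative\<close>.\<close>

lemma Ck_on_SucI:
  assumes "open S" "\<And>x. x \<in> S \<Longrightarrow> (f has_derivative f' x) (at x)" "\<And>v. Ck_on k S (\<lambda>x. f' x v)"
  shows "Ck_on (Suc k) S f"
  unfolding Ck_on.simps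
proof (intro conjI ballI allI)
  show "f differentiable at x" if "x \<in> S" for x
    using assms(2)[OF that] by (rule differentiableI)
  show "Ck_on k S (\<lambda>x. frechet_derivative f (at x) v)" for v
    by (rule Ck_on_cong[OF assms(1) _ assms(3)[of v]])
      (simp add: frechet_derivative_at[OF assms(2), symmetric])
qed

lemma Ck_on_Suc_has_derivative:
  "Ck_on (Suc k) S f \<Longrightarrow> x \<in> S \<Longrightarrow> (f has_derivative frechet_derivative f (at x)) (at x)"
  by (simp add: frechet_derivative_works)

lemma Ck_on_Suc_imp: "Ck_on (Suc k) S f \<Longrightarrow> Ck_on k S f"
proof (induction k arbitrary: f)
  case 0
  then show ?case
    by (auto intro!: continuous_at_imp_continuous_on differentiable_imp_continuous_within)
next
  case (Suc k)
  then show ?case by (metis Ck_on.simps(2))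
qed

lemma Ck_on_add:
  assumes "open S" "Ck_on k S f" "Ck_on k S g"
  shows "Ck_on k S (\<lambda>x. f x + g x)"
  using assms(2,3)
proof (induction k arbitrary: f g)
  case 0
  then show ?case by (auto intro: continuous_on_add)
next
  case (Suc k)
  show ?case
    by (rule Ck_on_SucI[OF assms(1)], rule has_derivative_add)
      (use Suc in \<open>auto simp: frechet_derivative_works\<close>)
qed

text \<open>By the Leibniz rule the derivative is a sum of two terms of the same shape, so the
  induction closes once \<open>f\<close> and \<open>g\<close> are arbitrary. This covers scalar
  multiples, inner products and matrix-vector products at once.\<close>

lemma Ck_on_bounded_bilinear:
  assumes "bounded_bilinear b" "open S" "Ck_on k S f" "Ck_on k S g"
  shows "Ck_on k S (\<lambda>x. b (f x) (g x))"
  using assms(3,4)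
proof (induction k arbitrary: f g)
  case 0
  then show ?case by (auto intro: bounded_bilinear.continuous_on[OF assms(1)])
next
  case (Suc k)
  show ?case
  proof (rule Ck_on_SucI[OF assms(2)], rule bounded_bilinear.FDERIV[OF assms(1)])
    show "Ck_on k S (\<lambda>x. b (f x) (frechet_derivative g (at x) v) + b (frechet_derivative f (at x) v) (g x))" for v
      using Suc.prems Ck_on_Suc_imp[OF Suc.prems(1)] Ck_on_Suc_imp[OF Suc.prems(2)]
      by (intro Ck_on_add[OF assms(2)] Suc.IH) auto
  qed (use Suc in \<open>auto simp: frechet_derivative_works\<close>)
qed

lemma Ck_on_bounded_linear:
  assumes "bounded_linear l" "open S" "Ck_on k S f"
  shows "Ck_on k S (\<lambda>x. l (f x))"
  using assms(3)
proof (induction k arbitrary: f)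
  case 0
  then show ?case by (auto intro: bounded_linear.continuous_on[OF assms(1)])
next
  case (Suc k)
  show ?case
    by (rule Ck_on_SucI[OF assms(2)], rule bounded_linear.has_derivative[OF assms(1)])
      (use Suc in \<open>auto simp: frechet_derivative_works\<close>)
qed

text \<open>Differentiation lowers the exponent, hence the induction with \<open>a\<close>
  arbitrary. The exponent \<open>- 1 / 2\<close> serves to normalise vectors in the Gram-Schmidt
  process.\<close>

lemma Ck_on_powr:
  fixes f :: "'a::euclidean_space \<Rightarrow> real"
  assumes "open S" "Ck_on k S f" "\<And>x. x \<in> S \<Longrightarrow> f x > 0"
  shows "Ck_on k S (\<lambda>x. f x powr a)"
  using assms(2)
proof (induction k arbitrary: a)
  case 0
  then show ?case using assms(3) by (fastforce intro!: continuous_on_powr continuous_on_const)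
next
  case (Suc k)
  show ?case
  proof (rule Ck_on_SucI[OF assms(1)])
    show "((\<lambda>x. f x powr a) has_derivative
        (\<lambda>v. (a * f x powr (a - 1)) * frechet_derivative f (at x) v)) (at x)" if "x \<in> S" for x
      using has_derivative_compose[OF Ck_on_Suc_has_derivative[OF Suc.prems that]
          has_real_derivative_powr[OF assms(3)[OF that], of a, unfolded has_field_derivative_def]] .
    show "Ck_on k S (\<lambda>x. (a * f x powr (a - 1)) * frechet_derivative f (at x) v)" for v
      using Suc.prems Ck_on_Suc_imp[OF Suc.prems] Suc.IH
      by (intro Ck_on_bounded_bilinear[OF bounded_bilinear_mult assms(1)] Ck_const) auto
  qed
qed

lemma Ck_on_sum:
  assumes "open S" "\<And>i. i \<in> I \<Longrightarrow> Ck_on k S (f i)"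
  shows "Ck_on k S (\<lambda>x. \<Sum>i\<in>I. f i x)"
  using assms(2)
  by (induction I rule: infinite_finite_induct) (auto simp: Ck_const intro!: Ck_on_add[OF assms(1)])

section \<open>Smooth orthonormal frames\<close>

lemma bounded_bilinear_matrix_vector_mult:
  "bounded_bilinear ((*v) :: real ^ 'n::finite ^ 'm::finite \<Rightarrow> _)"
  by (simp add: bilinear_conv_bounded_bilinear[symmetric] bilinear_def linear_iff matrix_vector_mult_add_rdistrib
      matrix_vector_right_distrib scalar_mult_eq_scaleR matrix_vector_mult_scaleR)
    (simp add: matrix_vector_mult_def vec_eq_iff sum_distrib_left mult_ac)

text \<open>The last conjunct, triangularity of the frame, is what keeps the next vector of the process
  nonzero.\<close>

lemma gram_schmidt_smooth:
  fixes g :: "real ^ 'n::finite \<Rightarrow> real ^ 'n ^ 'n"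
  assumes "open S" "smooth_on S g"
    and sym: "\<And>x. x \<in> S \<Longrightarrow> transpose (g x) = g x"
    and pos: "\<And>x v. x \<in> S \<Longrightarrow> v \<noteq> 0 \<Longrightarrow> v \<bullet> (g x *v v) > 0"
  shows "\<exists>E. (\<forall>i\<in>I. smooth_on S (E i)) \<and>
     (\<forall>x\<in>S. \<forall>i\<in>I. \<forall>j\<in>I. E i x \<bullet> (g x *v E j x) = (if i = j then 1 else 0)) \<and>
     (\<forall>x\<in>S. \<forall>i\<in>I. \<forall>j. j \<notin> I \<longrightarrow> E i x $ j = 0)"
  using finite[of I]
proof (induction I rule: finite_induct)
  case empty
  then show ?case by simp
next
  case (insert a I)
  then obtain E where sm: "\<And>i. i \<in> I \<Longrightarrow> smooth_on S (E i)"
    and on: "\<And>x i j. x \<in> S \<Longrightarrow> i \<in> I \<Longrightarrow> j \<in> I \<Longrightarrow> E i x \<bullet> (g x *v E j x) = (if i = j then 1 else 0)"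
    and sp: "\<And>x i j. x \<in> S \<Longrightarrow> i \<in> I \<Longrightarrow> j \<notin> I \<Longrightarrow> E i x $ j = 0"
    by blast
  \<comment> \<open>\<open>w\<close> is \<open>axis a 1\<close> minus its projections, with respect
    to \<open>g x\<close>, onto the vectors already built; \<open>e\<close> is \<open>w\<close>
    scaled to unit length.\<close>
  define w :: "real ^ 'n \<Rightarrow> real ^ 'n" where
    "w x = axis a 1 + (\<Sum>i\<in>I. - (E i x \<bullet> (g x *v axis a 1)) *\<^sub>R E i x)" for x
  define e where "e x = (w x \<bullet> (g x *v w x)) powr (- 1 / 2) *\<^sub>R w x" for x
  have symI: "u \<bullet> (g x *v v) = v \<bullet> (g x *v u)" if "x \<in> S" for x u v
    by (metis sym[OF that] dot_lmul_matrix inner_commute transpose_matrix_vector)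
  have ort: "E i x \<bullet> (g x *v w x) = 0" if "x \<in> S" "i \<in> I" for x i
  proof -
    have "E i x \<bullet> (g x *v w x) = w x \<bullet> (g x *v E i x)"
      by (rule symI[OF that(1)])
    also have "\<dots> = axis a 1 \<bullet> (g x *v E i x) - (\<Sum>j\<in>I. (E j x \<bullet> (g x *v axis a 1)) * (if j = i then 1 else 0))"
      using on that by (simp add: w_def inner_diff_left inner_sum_left sum_negf cong: sum.cong)
    also have "\<dots> = 0"
      using that insert.hyps(1) symI[OF that(1)] by (simp add: if_distrib cong: if_cong)
    finally show ?thesis .
  qed
  \<comment> \<open>The vectors \<open>E i x\<close> with \<open>i \<in> I\<close> have no component
    at \<open>a\<close>, so the entry 1 of \<open>axis a 1\<close> survives the projections.\<close>
  have w_a: "w x $ a = 1" if "x \<in> S" for x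
    using sp that insert.hyps by (simp add: w_def)
  have w_0: "w x $ j = 0" if "x \<in> S" "j \<notin> insert a I" for x j
    using sp that insert.hyps by (simp add: w_def axis_def)
  have pw: "w x \<bullet> (g x *v w x) > 0" if "x \<in> S" for x
    by (rule pos[OF that]) (use w_a[OF that] in auto)
  have ee: "e x \<bullet> (g x *v e x) = 1" if "x \<in> S" for x
  proof -
    have "e x \<bullet> (g x *v e x) = (w x \<bullet> (g x *v w x)) powr (- 1 / 2) * (w x \<bullet> (g x *v w x)) powr (- 1 / 2) * (w x \<bullet> (g x *v w x))"
      by (simp add: e_def matrix_vector_mult_scaleR)
    also have "\<dots> = 1"
      using pw[OF that] by (simp add: powr_minus powr_half_sqrt field_simps)
    finally show ?thesis .
  qed
  have Ee: "E i x \<bullet> (g x *v e x) = 0" if "x \<in> S" "i \<in> I" for x i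
    by (simp add: e_def matrix_vector_mult_scaleR ort that)
  have sm_w: "Ck_on k S w" for k
  proof -
    have g: "Ck_on k S g" and E: "Ck_on k S (E i)" if "i \<in> I" for i
      using assms(2) sm[OF that] by (auto simp: smooth_on_def)
    have "Ck_on k S (\<lambda>x. - (E i x \<bullet> (g x *v axis a 1)) *\<^sub>R E i x)" if "i \<in> I" for i
      by (intro Ck_on_bounded_bilinear[OF bounded_bilinear_scaleR assms(1) _ E[OF that]]
          Ck_on_bounded_linear[OF bounded_linear_minus[OF bounded_linear_ident] assms(1)]
          Ck_on_bounded_bilinear[OF bounded_bilinear_inner assms(1) E[OF that]]
          Ck_on_bounded_bilinear[OF bounded_bilinear_matrix_vector_mult assms(1) g[OF that] Ck_const])
    then show ?thesis
      unfolding w_def[abs_def] by (intro Ck_on_add[OF assms(1) Ck_const] Ck_on_sum[OF assms(1)])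
  qed
  have sm_e: "Ck_on k S e" for k
  proof -
    have "Ck_on k S g" using assms(2) by (auto simp: smooth_on_def)
    then have "Ck_on k S (\<lambda>x. w x \<bullet> (g x *v w x))"
      by (intro Ck_on_bounded_bilinear[OF bounded_bilinear_inner assms(1) sm_w]
        Ck_on_bounded_bilinear[OF bounded_bilinear_matrix_vector_mult assms(1) _ sm_w])
    from Ck_on_bounded_bilinear[OF bounded_bilinear_scaleR assms(1) Ck_on_powr[OF assms(1) this pw] sm_w]
    show ?thesis unfolding e_def[abs_def] .
  qed
  show ?case
  proof (intro exI[of _ "E(a := e)"] conjI ballI allI impI)
    fix x i j assume "x \<in> S" "i \<in> insert a I" "j \<in> insert a I"
    then show "(E(a := e)) i x \<bullet> (g x *v (E(a := e)) j x) = (if i = j then 1 else 0)"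
      using insert.hyps on Ee ee symI[of x "e x" "E j x"] by auto
  next
    fix x i j assume "x \<in> S" "i \<in> insert a I" "j \<notin> insert a I"
    then show "(E(a := e)) i x $ j = 0"
      using insert.hyps sp w_0 by (auto simp: e_def)
  qed (use sm sm_e in \<open>auto simp: smooth_on_def\<close>)
qed

section \<open>The strong maximum principle\<close>

text \<open>Restrict \<open>u\<close> to the line through \<open>q\<close> in direction
  \<open>e\<close>. Its slope vanishes at \<open>q\<close>; if \<open>H e \<bullet> e\<close> were
  positive, the slope would be positive just after \<open>q\<close> and \<open>u\<close> would
  exceed its maximum.\<close>

lemma second_derivative_test:
  fixes u :: "'a::real_inner \<Rightarrow> real"
  assumes "open T" "q \<in> T" and max: "\<And>x. x \<in> T \<Longrightarrow> u x \<le> u q"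
    and du: "\<And>x. x \<in> T \<Longrightarrow> (u has_derivative (\<lambda>v. G x \<bullet> v)) (at x)"
    and dG: "(G has_derivative H) (at q)"
  shows "G q = 0" "H e \<bullet> e \<le> 0"
proof -
  have "(\<lambda>v. G q \<bullet> v) = (\<lambda>v. 0)"
    using differential_zero_maxmin[OF assms(2,1) du[OF assms(2)]] max by blast
  then show G0: "G q = 0"
    by (metis inner_eq_zero_iff)
  define l where "l s = q + s *\<^sub>R e" for s :: real
  have dl: "(l has_derivative (\<lambda>s. s *\<^sub>R e)) (at s)" for s
    unfolding l_def by (auto intro!: derivative_eq_intros)
  have "continuous (at 0) l"
    using dl by (rule has_derivative_continuous)
  then have "isCont l 0" by simp
  moreover have "l 0 \<in> T" using assms(2) by (simp add: l_def)
  ultimately have "\<forall>\<^sub>F s in at 0. l s \<in> T"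
    using assms(1) by (metis isCont_def topological_tendstoD)
  then obtain d where d: "d > 0" "\<And>s. s \<noteq> 0 \<Longrightarrow> \<bar>s\<bar> < d \<Longrightarrow> l s \<in> T"
    by (auto simp: eventually_at dist_real_def)
  then have lT: "l s \<in> T" if "\<bar>s\<bar> < d" for s
    using that \<open>l 0 \<in> T\<close> by (cases "s = 0") auto
  have du1: "((\<lambda>s. u (l s)) has_real_derivative G (l s) \<bullet> e) (at s)" if "\<bar>s\<bar> < d" for s
    using has_derivative_compose[OF dl du[OF lT[OF that]]]
    by (simp add: has_field_derivative_def mult.commute[of _ "G (l s) \<bullet> e"])
  have "((\<lambda>s. G (l s)) has_derivative (\<lambda>s. H (s *\<^sub>R e))) (at 0)"
    using has_derivative_compose[OF dl, of G H 0] dG by (simp add: l_def)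
  then have "((\<lambda>s. G (l s) \<bullet> e) has_derivative (\<lambda>s. H (s *\<^sub>R e) \<bullet> e)) (at 0)"
    by (auto intro!: derivative_eq_intros)
  moreover have "H (s *\<^sub>R e) = s *\<^sub>R H e" for s
    using dG by (simp add: has_derivative_def bounded_linear.linear linear_scale)
  ultimately have d2: "((\<lambda>s. G (l s) \<bullet> e) has_real_derivative H e \<bullet> e) (at 0)"
    by (simp add: has_field_derivative_def mult.commute[of _ "H e \<bullet> e"])
  show "H e \<bullet> e \<le> 0"
  proof (rule ccontr)
    assume "\<not> H e \<bullet> e \<le> 0"
    then obtain d' where d': "d' > 0" "\<And>h. h > 0 \<Longrightarrow> h < d' \<Longrightarrow> G (l 0) \<bullet> e < G (l h) \<bullet> e"
      using DERIV_pos_inc_right[OF d2] by auto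
    \<comment> \<open>Up to the parameter \<open>r\<close> the line stays in \<open>T\<close> and,
      after 0, has positive slope.\<close>
    define r where "r = min d d' / 2"
    have r: "r > 0" "r < d" "r < d'" using d d' by (auto simp: r_def)
    have "u (l 0) < u (l r)"
    proof (rule DERIV_pos_imp_increasing_open[OF r(1)])
      fix s assume s: "0 < s" "s < r"
      then have "G (l s) \<bullet> e > 0" using d'(2)[of s] r G0 by (simp add: l_def)
      then show "\<exists>y. ((\<lambda>s. u (l s)) has_real_derivative y) (at s) \<and> 0 < y"
        using du1[of s] s r by auto
    next
      show "continuous_on {0..r} (\<lambda>s. u (l s))"
      proof (intro continuous_at_imp_continuous_on ballI)
        show "isCont (\<lambda>s. u (l s)) s" if "s \<in> {0..r}" for s
          using DERIV_isCont[OF du1, of s] that r by auto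
      qed
    qed
    with max[of "l r"] lT[of r] r show False by (simp add: l_def)
  qed
qed

text \<open>Start from a point of \<open>K\<close> that is not interior and a point \<open>p\<close>
  off \<open>K\<close> near it. The ball about \<open>p\<close> that reaches the nearest point
  \<open>z\<close> of \<open>K\<close> may touch \<open>K\<close> in several points; the ball of
  half the radius about the midpoint of \<open>p\<close> and \<open>z\<close> touches it only in
  \<open>z\<close>.\<close>

lemma touching_ball:
  fixes K :: "'a::euclidean_space set"
  assumes "open S" "closedin (top_of_set S) K" "\<not> open K"
  obtains p z R where "z \<in> K" "R > 0" "dist p z = R" "cball p R \<inter> K = {z}"
proof -
  obtain C where C: "closed C" "K = S \<inter> C"
    using assms(2) by (auto simp: closedin_closed)
  obtain x0 where x0: "x0 \<in> K" "\<And>e. e > 0 \<Longrightarrow> \<not> ball x0 e \<subseteq> K"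
    using assms(3) by (auto simp: open_contains_ball)
  then obtain r where r: "r > 0" "cball x0 r \<subseteq> S"
    using assms(1) C by (auto simp: open_contains_cball)
  obtain p where p: "dist x0 p < r / 2" "p \<notin> K"
    using x0(2)[of "r/2"] r by (auto simp: subset_iff)
  \<comment> \<open>\<open>K\<close> is closed only relative to \<open>S\<close>, so the nearest
    point is sought in a closed ball inside \<open>S\<close>. As \<open>p\<close> is within
    \<open>r / 2\<close> of \<open>x0\<close>, every point as close to \<open>p\<close> as
    \<open>z\<close> is lies in that ball.\<close>
  have "closed (C \<inter> cball x0 r)" "C \<inter> cball x0 r \<noteq> {}"
    using C x0 r by auto
  then obtain z where z: "z \<in> C \<inter> cball x0 r" "\<And>y. y \<in> C \<inter> cball x0 r \<Longrightarrow> dist p z \<le> dist p y"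
    using distance_attains_inf[of "C \<inter> cball x0 r" p] by blast
  have zK: "z \<in> K" using z r C by auto
  define R where "R = dist p z / 2"
  define p' where "p' = midpoint p z"
  have pz: "2 * R \<le> dist p x0" using z(2)[of x0] x0 C r by (auto simp: R_def)
  have "R > 0" using zK p by (auto simp: R_def)
  have pp: "dist p p' = R" "dist p' z = R"
    by (simp_all add: R_def p'_def dist_midpoint)
  have only: "y = z" if y: "y \<in> K" "dist p' y \<le> R" for y
  proof -
    have 1: "dist p y \<le> 2 * R" using dist_triangle[of p y p'] pp y by simp
    then have "dist x0 y < r" using dist_triangle[of x0 y p] pz p by (simp add: dist_commute)
    then have "dist p z \<le> dist p y" using z(2)[of y] y C by auto
    then have 2: "norm ((p' - p) + (y - p')) = 2 * R"
      using 1 by (simp add: R_def dist_norm norm_minus_commute)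
    \<comment> \<open>Equality case of the triangle inequality by the parallelogram law: two vectors
      of norm at most \<open>R\<close> whose sum has norm \<open>2 * R\<close> coincide.\<close>
    have "(norm ((p' - p) - (y - p')))\<^sup>2 = 2 * (norm (p' - p))\<^sup>2 + 2 * (norm (y - p'))\<^sup>2 - (norm ((p' - p) + (y - p')))\<^sup>2"
      unfolding power2_norm_eq_inner by (simp add: inner_diff inner_add inner_commute)
    also have "\<dots> = 2 * (norm (y - p'))\<^sup>2 - 2 * R\<^sup>2"
      using 2 pp by (simp add: dist_norm norm_minus_commute power2_eq_square)
    also have "\<dots> \<le> 0"
      using y(2) power_mono[of "norm (y - p')" R 2] by (simp add: dist_norm norm_minus_commute)
    finally have "p' - p = y - p'" by simp
    then have "y = 2 *\<^sub>R p' - p" by (simp add: scaleR_2 algebra_simps)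
    then show ?thesis by (simp add: p'_def midpoint_def)
  qed
  have "cball p' R \<inter> K = {z}"
  proof (intro equalityI subsetI)
    show "y \<in> {z}" if "y \<in> cball p' R \<inter> K" for y using only[of y] that by simp
    show "y \<in> cball p' R \<inter> K" if "y \<in> {z}" for y using that zK pp by simp
  qed
  with that zK \<open>R > 0\<close> pp show ?thesis by blast
qed

text \<open>Hopf's barrier \<open>exp (- \<alpha> * (dist x p)\<^sup>2)\<close>, added to \<open>u\<close> near a point where a ball touches
  the set \<open>{u = M}\<close> from outside, would produce an interior maximum at which the operator is
  positive.\<close>

lemma strong_maximum_principle:
  fixes u :: "'a::euclidean_space \<Rightarrow> real" and E :: "'i::finite \<Rightarrow> 'a \<Rightarrow> 'a"
  assumes "open S"
    and du: "\<And>x. x \<in> S \<Longrightarrow> (u has_derivative (\<lambda>v. G x \<bullet> v)) (at x)"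
    and dG: "\<And>x. x \<in> S \<Longrightarrow> (G has_derivative H x) (at x)"
    and cE: "\<And>i. continuous_on S (E i)" and cB: "continuous_on S B"
    and ell: "\<And>x v. x \<in> S \<Longrightarrow> (\<And>i. v \<bullet> E i x = 0) \<Longrightarrow> v = 0"
    and L: "\<And>x. x \<in> S \<Longrightarrow> (\<Sum>i\<in>UNIV. H x (E i x) \<bullet> E i x) + G x \<bullet> B x \<ge> 0"
    and le: "\<And>x. x \<in> S \<Longrightarrow> u x \<le> M"
  shows "open {x \<in> S. u x = M}"
proof (rule ccontr)
  assume no: "\<not> open {x \<in> S. u x = M}"
  have cu: "continuous_on S u"
    using du by (meson continuous_at_imp_continuous_on has_derivative_continuous)
  then have "closedin (top_of_set S) {x \<in> S. u x = M}"
    by (rule continuous_closedin_preimage_constant)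
  then obtain p z R where z: "z \<in> S" "u z = M" and R: "R > 0" "dist p z = R"
    and touch: "cball p R \<inter> {x \<in> S. u x = M} = {z}"
    using touching_ball[OF assms(1) _ no] by (metis (mono_tags, lifting) mem_Collect_eq)
  \<comment> \<open>The operator maps the barrier \<open>W\<close> defined below to
    \<open>2 * a * W x * (2 * a * P x - Q x)\<close>: \<open>P\<close> is the second-order form
    evaluated at \<open>x - p\<close>, and \<open>Q\<close> gathers the trace and the drift.\<close>
  define P where "P x = (\<Sum>i\<in>UNIV. ((x - p) \<bullet> E i x)\<^sup>2)" for x
  define Q where "Q x = (\<Sum>i\<in>UNIV. E i x \<bullet> E i x) + (x - p) \<bullet> B x" for x
  have cP: "continuous_on S P" and cQ: "continuous_on S Q"
    unfolding P_def Q_def by (intro continuous_intros cE cB)+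
  have "P z > 0"
  proof (rule ccontr)
    assume "\<not> P z > 0"
    then have "P z = 0" unfolding P_def by (meson not_less order_antisym sum_nonneg zero_le_power2)
    then have "(z - p) \<bullet> E i z = 0" for i unfolding P_def by (simp add: sum_nonneg_eq_0_iff)
    then have "z - p = 0" by (rule ell[OF z(1)])
    with R show False by simp
  qed
  \<comment> \<open>This gives \<open>a * P z = \<bar>Q z\<bar> + 1\<close>. On \<open>T\<close>,
    where \<open>P\<close> keeps more than half its value at \<open>z\<close> and \<open>Q\<close>
    rises by less than 1, \<open>2 * a * P x - Q x\<close> is therefore positive.\<close>
  define a where "a = (\<bar>Q z\<bar> + 1) / P z"
  have "a > 0" using \<open>P z > 0\<close> by (simp add: a_def)
  define T where "T = (S \<inter> P -` {P z / 2 <..}) \<inter> (S \<inter> Q -` {..< Q z + 1})"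
  have "open T" unfolding T_def
    by (intro open_Int continuous_open_preimage cP cQ assms(1)) auto
  moreover have "z \<in> T" using z \<open>P z > 0\<close> by (auto simp: T_def)
  ultimately obtain \<rho> where \<rho>: "\<rho> > 0" "cball z \<rho> \<subseteq> T"
    by (auto simp: open_contains_cball)
  have TS: "T \<subseteq> S" by (auto simp: T_def)
  define W where "W x = exp (- a * ((x - p) \<bullet> (x - p)))" for x
  define GW where "GW x = (- 2 * a * W x) *\<^sub>R (x - p)" for x
  define HW where "HW x v = (- 2 * a) *\<^sub>R ((- 2 * a * W x * ((x - p) \<bullet> v)) *\<^sub>R (x - p) + W x *\<^sub>R v)" for x v
  have dW: "(W has_derivative (\<lambda>v. GW x \<bullet> v)) (at x)" for x
    unfolding W_def GW_def
    by (auto intro!: derivative_eq_intros simp: inner_commute algebra_simps)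
  have dGW: "(GW has_derivative HW x) (at x)" for x
    unfolding GW_def HW_def
    by (rule derivative_eq_intros dW refl)+
      (simp add: fun_eq_iff GW_def algebra_simps)
  have LW: "(\<Sum>i\<in>UNIV. HW x (E i x) \<bullet> E i x) + GW x \<bullet> B x > 0" if "x \<in> T" for x
  proof -
    have "a * P z = \<bar>Q z\<bar> + 1" using \<open>P z > 0\<close> by (simp add: a_def)
    moreover have "Q x < Q z + 1" "a * (P z / 2) < a * P x"
      using that \<open>a > 0\<close> by (auto simp: T_def)
    ultimately have "2 * a * P x - Q x > 0" by (simp add: abs_if split: if_splits)
    then have "2 * a * W x * (2 * a * P x - Q x) > 0"
      using \<open>a > 0\<close> by (simp add: W_def)
    also have "2 * a * W x * (2 * a * P x - Q x) = (\<Sum>i\<in>UNIV. HW x (E i x) \<bullet> E i x) + GW x \<bullet> B x"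
      by (simp add: HW_def GW_def P_def Q_def inner_add_left power2_eq_square sum.distrib sum_distrib_left algebra_simps sum_negf sum_subtractf)
    finally show ?thesis .
  qed
  have W1: "W x \<le> 1" for x using \<open>a > 0\<close> by (simp add: W_def)
  \<comment> \<open>The only contact point \<open>z\<close> is the centre of the small sphere, so
    \<open>u < M\<close> on the part of that sphere inside the touching ball; compactness makes the
    gap uniform.\<close>
  have "\<exists>\<delta>>0. \<forall>x \<in> sphere z \<rho> \<inter> cball p R. u x \<le> M - \<delta>"
  proof (cases "sphere z \<rho> \<inter> cball p R = {}")
    case True then show ?thesis by (auto intro: exI[of _ 1])
  next
    case False
    have sub: "sphere z \<rho> \<inter> cball p R \<subseteq> S"
      using \<rho> TS sphere_cball by blast
    have "compact (sphere z \<rho> \<inter> cball p R)" by (simp add: compact_Int_closed)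
    then obtain y where y: "y \<in> sphere z \<rho> \<inter> cball p R" "\<forall>x\<in>sphere z \<rho> \<inter> cball p R. u x \<le> u y"
      using continuous_attains_sup False continuous_on_subset[OF cu sub] by meson
    have "y \<noteq> z" using y(1) \<rho> by auto
    then have "u y \<noteq> M" using y(1) sub touch by blast
    with le[of y] y(1) sub have "u y < M" by force
    with y(2) show ?thesis by (intro exI[of _ "M - u y"]) auto
  qed
  then obtain \<delta> where \<delta>: "\<delta> > 0" "\<And>x. x \<in> sphere z \<rho> \<inter> cball p R \<Longrightarrow> u x \<le> M - \<delta>"
    by blast
  define e where "e = \<delta> / 2"
  have "e > 0" using \<delta> by (simp add: e_def)
  define f where "f x = u x + e * W x" for x
  have Wz: "W z = exp (- a * R\<^sup>2)"
    using R by (simp add: W_def dist_norm norm_minus_commute power2_norm_eq_inner[symmetric])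
  \<comment> \<open>Inside the touching ball the gap \<open>2 * e\<close> outweighs
    \<open>e * W x \<le> e\<close>; outside it \<open>W\<close> is below its value at
    \<open>z\<close>, while \<open>u\<close> is at most \<open>M = u z\<close>.\<close>
  have sph: "f x < f z" if "x \<in> sphere z \<rho>" for x
  proof (cases "x \<in> cball p R")
    case True
    have "e * W x \<le> e" using W1[of x] \<open>e > 0\<close> by simp
    moreover have "e * W z > 0" using \<open>e > 0\<close> by (simp add: W_def)
    moreover have "u x \<le> M - 2 * e" using \<delta>(2)[of x] True that by (simp add: e_def)
    ultimately show ?thesis unfolding f_def z(2) using \<open>e > 0\<close> by linarith
  next
    case False
    then have "R\<^sup>2 < (norm (x - p))\<^sup>2"
      using R by (intro power_strict_mono) (auto simp: dist_norm norm_minus_commute)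
    then have "W x < W z"
      unfolding Wz using \<open>a > 0\<close> by (simp add: W_def power2_norm_eq_inner)
    moreover have "x \<in> S" using that \<rho> TS sphere_cball by blast
    ultimately show ?thesis using le[of x] z \<open>e > 0\<close> by (simp add: f_def add_le_less_mono)
  qed
  have df: "(f has_derivative (\<lambda>v. (G x + e *\<^sub>R GW x) \<bullet> v)) (at x)" if "x \<in> S" for x
    unfolding f_def
    by (rule derivative_eq_intros du[OF that] dW refl)+ (simp add: fun_eq_iff inner_add_left)
  have "continuous_on (cball z \<rho>) f"
    using df \<rho> TS by (meson continuous_at_imp_continuous_on has_derivative_continuous subsetD)
  \<comment> \<open>By \<open>sph\<close> this maximum is interior, so the operator applied to
    \<open>f\<close> is at most 0 at \<open>q\<close>; but \<open>L\<close> and \<open>LW\<close>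
    make it positive there.\<close>
  then obtain q where q: "q \<in> cball z \<rho>" "\<And>x. x \<in> cball z \<rho> \<Longrightarrow> f x \<le> f q"
    using continuous_attains_sup[of "cball z \<rho>" f] \<rho> by auto
  have "q \<notin> sphere z \<rho>" using sph[of q] q(2)[of z] \<rho> by auto
  with q(1) have qb: "q \<in> ball z \<rho>" by auto
  then have qT: "q \<in> T" "q \<in> S" using \<rho> TS ball_subset_cball by blast+
  have dq: "((\<lambda>x. G x + e *\<^sub>R GW x) has_derivative (\<lambda>v. H q v + e *\<^sub>R HW q v)) (at q)"
    by (intro derivative_intros dG[OF qT(2)] dGW)
  have *: "f x \<le> f q" "(f has_derivative (\<lambda>v. (G x + e *\<^sub>R GW x) \<bullet> v)) (at x)" if "x \<in> ball z \<rho>" for x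
    using that q(2)[of x] df[of x] \<rho>(2) TS ball_subset_cball[of z \<rho>] by blast+
  have G0: "G q + e *\<^sub>R GW q = 0"
    by (rule second_derivative_test(1)[OF open_ball qb * dq])
  have "(H q (E i q) + e *\<^sub>R HW q (E i q)) \<bullet> E i q \<le> 0" for i
    by (rule second_derivative_test(2)[OF open_ball qb * dq])
  then have "(\<Sum>i\<in>UNIV. (H q (E i q) + e *\<^sub>R HW q (E i q)) \<bullet> E i q) + (G q + e *\<^sub>R GW q) \<bullet> B q \<le> 0"
    by (simp add: G0 sum_nonpos)
  then have "((\<Sum>i\<in>UNIV. H q (E i q) \<bullet> E i q) + G q \<bullet> B q)
      + e * ((\<Sum>i\<in>UNIV. HW q (E i q) \<bullet> E i q) + GW q \<bullet> B q) \<le> 0"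
    by (simp add: inner_add_left sum.distrib sum_distrib_left algebra_simps)
  moreover have "e * ((\<Sum>i\<in>UNIV. HW q (E i q) \<bullet> E i q) + GW q \<bullet> B q) > 0"
    using LW[OF qT(1)] \<open>e > 0\<close> by simp
  ultimately show False using L[OF qT(2)] by linarith
qed

text \<open>By compactness the maximum is attained; its level set is nonempty, closed by continuity
  and open by hypothesis, hence the whole connected space.\<close>

lemma constant_on_if_open_max_sets:
  fixes v :: "'a \<Rightarrow> real"
  assumes "compact_space X" "connected_space X" "continuous_map X euclidean v"
    and "\<And>M. (\<And>y. y \<in> topspace X \<Longrightarrow> v y \<le> M) \<Longrightarrow> openin X {y \<in> topspace X. v y = M}"
  shows "v constant_on topspace X"
proof (cases "topspace X = {}")
  case True
  then show ?thesis by (simp add: constant_on_def)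
next
  case False
  have "compact (v ` topspace X)"
    using image_compactin[OF _ assms(3), of "topspace X"] assms(1) by (simp add: compact_space_def)
  then obtain x where x: "x \<in> topspace X" "\<And>y. y \<in> topspace X \<Longrightarrow> v y \<le> v x"
    using compact_attains_sup[of "v ` topspace X"] False by blast
  have "openin X {y \<in> topspace X. v y = v x}"
    using x(2) by (rule assms(4))
  moreover have "closedin X {y \<in> topspace X. v y \<in> {v x}}"
    by (rule closedin_continuous_map_preimage[OF assms(3)]) simp
  ultimately have "{y \<in> topspace X. v y = v x} = topspace X"
    using assms(2) x(1) by (auto simp: connected_space_clopen_in)
  then show ?thesis by (auto simp: constant_on_def)
qed

text \<open>Within a chart domain the set is the preimage of an open set under the chart. Chart
  domains are open, so these pieces are open in \<open>X\<close>, and they cover.\<close>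

lemma openin_if_open_in_charts:
  assumes cov: "\<Union> (fst ` A) = topspace X" and ch: "\<And>c. c \<in> A \<Longrightarrow> chart_on X c"
    and op: "\<And>c. c \<in> A \<Longrightarrow> open {z \<in> snd c ` fst c. P (chart_inv c z)}"
  shows "openin X {y \<in> topspace X. P y}"
proof -
  have "openin X {y \<in> fst c. P y}" if c: "c \<in> A" for c
  proof -
    have U: "openin X (fst c)" and h: "homeomorphic_map (subtopology X (fst c)) (top_of_set (snd c ` fst c)) (snd c)"
      using ch[OF c] by (auto simp: chart_on_def)
    have sub: "fst c \<subseteq> topspace X" using U by (rule openin_subset)
    have inj: "inj_on (snd c) (fst c)"
      using homeomorphic_imp_injective_map[OF h] sub by (simp add: inf_absorb2)
    have "continuous_map (subtopology X (fst c)) euclidean (snd c)"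
      using homeomorphic_imp_continuous_map[OF h] continuous_map_in_subtopology by blast
    then have "openin (subtopology X (fst c)) {y \<in> topspace (subtopology X (fst c)).
        snd c y \<in> {z \<in> snd c ` fst c. P (chart_inv c z)}}"
      by (rule openin_continuous_map_preimage) (use op[OF c] in \<open>simp only: open_openin[symmetric]\<close>)
    also have "\<dots> = {y \<in> fst c. P y}"
    proof -
      have "chart_inv c (snd c y) = y" if "y \<in> fst c" for y
        using inj that by (simp add: chart_inv_def)
      then have "snd c y \<in> {z \<in> snd c ` fst c. P (chart_inv c z)} \<longleftrightarrow> P y" if "y \<in> fst c" for y
        using that by (metis (mono_tags, lifting) imageI mem_Collect_eq)
      moreover have "topspace (subtopology X (fst c)) = fst c" using sub by auto
      ultimately show ?thesis by (simp cong: conj_cong del: mem_Collect_eq)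
    qed
    finally show ?thesis using U by (rule openin_trans_full)
  qed
  then have "openin X (\<Union>c\<in>A. {y \<in> fst c. P y})" by blast
  also have "(\<Union>c\<in>A. {y \<in> fst c. P y}) = {y \<in> topspace X. P y}" using cov by auto
  finally show ?thesis .
qed

section \<open>Harmonic maps in a frame\<close>

text \<open>\<open>matrix_inv\<close> is a choice of a two-sided inverse; a right inverse of a
  square matrix is two-sided, and inverses are unique.\<close>

lemma matrix_inv_eqI:
  fixes A B :: "real ^ 'n::finite ^ 'n"
  assumes "A ** B = mat 1"
  shows "matrix_inv A = B"
proof -
  have "A ** matrix_inv A = mat 1 \<and> matrix_inv A ** A = mat 1"
    unfolding matrix_inv_def
    by (rule someI[of _ B]) (use assms in \<open>simp add: matrix_left_right_inverse\<close>)
  then show ?thesis by (metis assms matrix_mul_assoc matrix_mul_lid matrix_mul_rid)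
qed

context
  fixes h :: "real ^ 'n::finite ^ 'n" and e :: "'n \<Rightarrow> real ^ 'n"
  assumes on: "\<And>i j. e i \<bullet> (h *v e j) = (if i = j then 1 else 0)"
begin

text \<open>If \<open>P\<close> has the frame vectors as columns, orthonormality reads
  \<open>transpose P ** h ** P = mat 1\<close>. All matrices are square, so \<open>P\<close> may be
  moved from the right end to the left.\<close>

lemma frame_matrix: "(\<chi> k l. \<Sum>i\<in>UNIV. e i $ k * e i $ l) ** h = mat 1"
proof -
  define P :: "real ^ 'n ^ 'n" where "P = (\<chi> k i. e i $ k)"
  have "((transpose P ** h) ** P) $ i $ j = (mat 1 :: real ^ 'n ^ 'n) $ i $ j" for i j
  proof -
    have "((transpose P ** h) ** P) $ i $ j = e i \<bullet> (h *v e j)"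
      by (simp add: P_def matrix_matrix_mult_def matrix_vector_mult_def transpose_def inner_vec_def
          sum_distrib_left sum_distrib_right mult.assoc) (rule sum.swap)
    then show ?thesis by (simp add: on mat_def)
  qed
  then have "(transpose P ** h) ** P = mat 1" by (simp add: vec_eq_iff)
  then have "(P ** transpose P) ** h = mat 1"
    by (simp add: matrix_left_right_inverse[of P] matrix_mul_assoc[symmetric])
  also have "P ** transpose P = (\<chi> k l. \<Sum>i\<in>UNIV. e i $ k * e i $ l)"
    by (simp add: P_def matrix_matrix_mult_def transpose_def)
  finally show ?thesis .
qed

text \<open>Makes the inverse metric polynomial in the frame, so that it inherits continuity from
  the frame.\<close>

lemma matrix_inv_frame: "matrix_inv h $ k $ l = (\<Sum>i\<in>UNIV. e i $ k * e i $ l)"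
  using matrix_inv_eqI[of h "\<chi> k l. \<Sum>i\<in>UNIV. e i $ k * e i $ l"] frame_matrix
  by (simp add: matrix_left_right_inverse)

text \<open>Ellipticity as the maximum principle asks for it, with the Euclidean inner product: the
  invertible matrix of \<open>frame_matrix\<close> sends \<open>v\<close> to the sum of the
  \<open>(v \<bullet> e i) *\<^sub>R e i\<close>.\<close>

lemma frame_nondegenerate:
  assumes "\<And>i. v \<bullet> e i = 0"
  shows "v = 0"
proof -
  have "v v* (\<chi> k l. \<Sum>i\<in>UNIV. e i $ k * e i $ l) = (\<Sum>i\<in>UNIV. (v \<bullet> e i) *\<^sub>R e i)"
    by (simp add: vec_eq_iff vector_matrix_mult_def inner_vec_def sum_distrib_left sum_distrib_right
        mult_ac, intro allI, rule sum.swap)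
  then have "v v* (\<chi> k l. \<Sum>i\<in>UNIV. e i $ k * e i $ l) = 0" by (simp add: assms)
  then have "v v* ((\<chi> k l. \<Sum>i\<in>UNIV. e i $ k * e i $ l) ** h) = 0"
    by (simp only: vector_matrix_mul_assoc[symmetric] vector_matrix_mult_0)
  then show ?thesis by (simp add: frame_matrix)
qed

end

section \<open>The tension field as an elliptic operator\<close>

lemma smooth_on_differentiable:
  "smooth_on S f \<Longrightarrow> x \<in> S \<Longrightarrow> (f has_derivative frechet_derivative f (at x)) (at x)"
  unfolding smooth_on_def using Ck_on_Suc_has_derivative by blast

lemma smooth_on_continuous: "smooth_on S f \<Longrightarrow> continuous_on S f"
  unfolding smooth_on_def by (metis Ck_on.simps(1))

lemma smooth_on_partial: "smooth_on S f \<Longrightarrow> smooth_on S (partial i f)"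
  unfolding smooth_on_def partial_def[abs_def] by (metis Ck_on.simps(2))

lemma frechet_derivative_partial:
  assumes "smooth_on S f" "x \<in> S"
  shows "frechet_derivative f (at x) v = (\<Sum>k\<in>UNIV. v $ k *\<^sub>R partial k f x)"
proof -
  have l: "linear (frechet_derivative f (at x))"
    using smooth_on_differentiable[OF assms] has_derivative_linear by blast
  have "frechet_derivative f (at x) v = frechet_derivative f (at x) (\<Sum>k\<in>UNIV. v $ k *\<^sub>R axis k 1)"
    using basis_expansion[of v] by (simp add: scalar_mult_eq_scaleR)
  also have "\<dots> = (\<Sum>k\<in>UNIV. v $ k *\<^sub>R partial k f x)"
    by (simp add: linear_sum[OF l] linear_scale[OF l] partial_def)
  finally show ?thesis .
qed

lemma continuous_on_christoffel:
  assumes "smooth_on S g" "orthonormal_frame g S E"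
  shows "continuous_on S (\<lambda>x. christoffel g k i j x)"
proof -
  have "continuous_on S (\<lambda>x. \<Sum>i\<in>UNIV. E i x $ k * E i x $ l)" for k l
    using assms(2) by (intro continuous_intros smooth_on_continuous) (auto simp: orthonormal_frame_def)
  moreover have "(\<Sum>i\<in>UNIV. E i x $ k * E i x $ l) = matrix_inv (g x) $ k $ l" if "x \<in> S" for x k l
    using matrix_inv_frame[of "\<lambda>i. E i x" "g x"] assms(2) that by (auto simp: orthonormal_frame_def)
  ultimately have 1: "continuous_on S (\<lambda>x. matrix_inv (g x) $ k $ l)" for k l
    by (simp cong: continuous_on_cong)
  have "partial i g x $ j $ l = partial i (\<lambda>z. g z $ j $ l) x" if "x \<in> S" for i j l x
  proof -
    have "((\<lambda>z. g z $ j $ l) has_derivative (\<lambda>v. frechet_derivative g (at x) v $ j $ l)) (at x)"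
      by (intro bounded_linear.has_derivative[OF bounded_linear_vec_nth] smooth_on_differentiable[OF assms(1) that])
    from frechet_derivative_at[OF this] show ?thesis by (simp add: partial_def fun_eq_iff)
  qed
  moreover have "continuous_on S (\<lambda>x. partial i g x $ j $ l)" for i j l
    by (intro continuous_intros smooth_on_continuous smooth_on_partial assms(1))
  ultimately have 2: "continuous_on S (partial i (\<lambda>z. g z $ j $ l))" for i j l
    by (simp cong: continuous_on_cong)
  show ?thesis
    unfolding christoffel_def by (intro continuous_intros 1 2)
qed

lemma continuous_on_christoffel_form:
  assumes "smooth_on S g" "orthonormal_frame g S E" "continuous_on S X" "continuous_on S Y"
  shows "continuous_on S (\<lambda>x. christoffel_form g x (X x) (Y x))"
  unfolding christoffel_form_def
  by (intro continuous_intros continuous_on_christoffel[OF assms(1,2)] assms(3,4))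

text \<open>Differentiating \<open>df (E i)\<close> along \<open>E i\<close> gives a Hessian term
  and \<open>df\<close> of the Euclidean derivative of \<open>E i\<close> along itself. The latter
  cancels against the same term in \<open>levi_civita\<close>, so no derivative of the frame
  remains.\<close>

lemma tension_eq:
  fixes f :: "real ^ 'n::finite \<Rightarrow> real ^ 'k::finite"
  assumes S: "open S" and f: "smooth_on S f" and E: "\<And>i. smooth_on S (E i)" and x: "x \<in> S"
  shows "tension g h f E x = (\<Sum>i\<in>UNIV.
     (\<Sum>k\<in>UNIV. E i x $ k *\<^sub>R frechet_derivative (partial k f) (at x) (E i x))
     + christoffel_form h (f x) (frechet_derivative f (at x) (E i x)) (frechet_derivative f (at x) (E i x))
     - frechet_derivative f (at x) (christoffel_form g x (E i x) (E i x)))"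
proof -
  have l: "linear (frechet_derivative f (at x))"
    using smooth_on_differentiable[OF f x] has_derivative_linear by blast
  have "frechet_derivative (\<lambda>z. frechet_derivative f (at z) (E i z)) (at x) (E i x) =
      (\<Sum>k\<in>UNIV. E i x $ k *\<^sub>R frechet_derivative (partial k f) (at x) (E i x))
      + frechet_derivative f (at x) (frechet_derivative (E i) (at x) (E i x))" for i
  proof -
    have "((\<lambda>z. \<Sum>k\<in>UNIV. E i z $ k *\<^sub>R partial k f z) has_derivative (\<lambda>v. \<Sum>k\<in>UNIV.
        E i x $ k *\<^sub>R frechet_derivative (partial k f) (at x) v + (frechet_derivative (E i) (at x) v $ k) *\<^sub>R partial k f x)) (at x)"
      by (intro derivative_intros bounded_linear.has_derivative[OF bounded_linear_vec_nth]
          smooth_on_differentiable[OF _ x] E smooth_on_partial f)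
    then have "((\<lambda>z. frechet_derivative f (at z) (E i z)) has_derivative (\<lambda>v. \<Sum>k\<in>UNIV.
        E i x $ k *\<^sub>R frechet_derivative (partial k f) (at x) v + (frechet_derivative (E i) (at x) v $ k) *\<^sub>R partial k f x)) (at x)"
      by (rule has_derivative_transform_within_open[OF _ S x]) (simp add: frechet_derivative_partial[OF f])
    from frechet_derivative_at[OF this, symmetric] show ?thesis
      by (simp add: sum.distrib frechet_derivative_partial[OF f x])
  qed
  then show ?thesis
    unfolding tension_def pullback_connection_def levi_civita_def
    by (simp add: linear_add[OF l] algebra_simps)
qed

text \<open>The field \<open>b\<close> turns the quadratic term into a first derivative of component
  \<open>j\<close>. That component then solves a linear elliptic equation without a term of order
  zero, and the strong maximum principle applies.\<close>

lemma open_max_set_component: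
  fixes f :: "real ^ 'n::finite \<Rightarrow> real ^ 'k::finite"
  assumes S: "open S" and g: "smooth_on S g" and f: "smooth_on S f" and E: "orthonormal_frame g S E"
    and tension: "\<And>x. x \<in> S \<Longrightarrow> tension g h f E x = 0"
    and b: "continuous_on S b"
      "\<And>x. x \<in> S \<Longrightarrow> (\<Sum>i\<in>UNIV. christoffel_form h (f x) (frechet_derivative f (at x) (E i x))
          (frechet_derivative f (at x) (E i x))) $ j = frechet_derivative f (at x) (b x) $ j"
    and le: "\<And>x. x \<in> S \<Longrightarrow> f x $ j \<le> M"
  shows "open {x \<in> S. f x $ j = M}"
proof -
  define G :: "real ^ 'n \<Rightarrow> real ^ 'n" where "G x = (\<chi> k. partial k f x $ j)" for x
  define H :: "real ^ 'n \<Rightarrow> real ^ 'n \<Rightarrow> real ^ 'n" where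
    "H x v = (\<chi> k. frechet_derivative (partial k f) (at x) v $ j)" for x v
  define B where "B x = b x - (\<Sum>i\<in>UNIV. christoffel_form g x (E i x) (E i x))" for x
  have Es: "smooth_on S (E i)" for i using E by (simp add: orthonormal_frame_def)
  have Df: "frechet_derivative f (at x) v $ j = G x \<bullet> v" if "x \<in> S" for x v
    by (simp add: frechet_derivative_partial[OF f that] G_def inner_vec_def mult.commute)
  show ?thesis
  proof (rule strong_maximum_principle[where G = G and H = H and E = E and B = B])
    fix x assume x: "x \<in> S"
    show "((\<lambda>x. f x $ j) has_derivative (\<lambda>v. G x \<bullet> v)) (at x)"
      using bounded_linear.has_derivative[OF bounded_linear_vec_nth[of j] smooth_on_differentiable[OF f x]]
      by (simp add: Df[OF x])
    show "(G has_derivative H x) (at x)"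
    proof (subst has_derivative_componentwise_within, intro ballI)
      fix w :: "real ^ 'n" assume "w \<in> Basis"
      then obtain k where w: "w = axis k 1" by (auto simp: Basis_vec_def)
      show "((\<lambda>x. G x \<bullet> w) has_derivative (\<lambda>v. H x v \<bullet> w)) (at x)"
        unfolding w G_def H_def inner_axis
        using bounded_linear.has_derivative[OF bounded_linear_vec_nth[of j]
            smooth_on_differentiable[OF smooth_on_partial[OF f, of k] x]] by simp
    qed
    show "v = 0" if "\<And>i. v \<bullet> E i x = 0" for v
      using frame_nondegenerate[of "\<lambda>i. E i x" "g x" v] E x that by (auto simp: orthonormal_frame_def)
    have l: "linear (frechet_derivative f (at x))"
      using smooth_on_differentiable[OF f x] has_derivative_linear by blast
    \<comment> \<open>Component \<open>j\<close> of the tension is exactly the operator with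
      second-order part \<open>E\<close> and drift \<open>B\<close>, so the required inequality
      holds with equality.\<close>
    have "0 = tension g h f E x $ j" using tension[OF x] by simp
    also have "\<dots> = (\<Sum>i\<in>UNIV. H x (E i x) \<bullet> E i x) + frechet_derivative f (at x) (b x) $ j
        - (\<Sum>i\<in>UNIV. frechet_derivative f (at x) (christoffel_form g x (E i x) (E i x)) $ j)"
      unfolding tension_eq[OF S f Es x] b(2)[OF x, symmetric]
      by (simp add: sum.distrib sum_subtractf H_def inner_vec_def mult.commute)
    also have "\<dots> = (\<Sum>i\<in>UNIV. H x (E i x) \<bullet> E i x) + G x \<bullet> B x"
      by (simp add: Df[OF x] B_def inner_diff_right inner_sum_right)
    finally show "(\<Sum>i\<in>UNIV. H x (E i x) \<bullet> E i x) + G x \<bullet> B x \<ge> 0" by simp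
  next
    show "continuous_on S (E i)" for i by (rule smooth_on_continuous[OF Es])
    then show "continuous_on S B" unfolding B_def
      by (intro continuous_intros b(1) continuous_on_christoffel_form[OF g E])
  qed (use S le in auto)
qed

section \<open>The Levi-Civita connection of Sol\<close>

lemma partial_exp:
  "partial i (\<lambda>z. exp (a * z $ 3)) (p :: real ^ 3) = (if i = 3 then a * exp (a * p $ 3) else 0)"
proof -
  have "((\<lambda>z. exp (a * z $ 3)) has_derivative (\<lambda>v. a * v $ 3 * exp (a * p $ 3))) (at p)"
    by (auto intro!: derivative_eq_intros bounded_linear.has_derivative[OF bounded_linear_vec_nth])
  from frechet_derivative_at[OF this, symmetric] show ?thesis
    by (simp add: partial_def axis_def)
qed

lemma partial_const: "partial i (\<lambda>z. c) p = 0"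
  by (simp add: partial_def frechet_derivative_const)

lemma matrix_inv_sol_metric:
  "matrix_inv (sol_metric m n p) = vector
     [vector [exp (2 * m * p $ 3), 0, 0], vector [0, exp (- 2 * n * p $ 3), 0], vector [0, 0, 1]]"
  by (rule matrix_inv_eqI)
    (simp add: vec_eq_iff forall_3 sol_metric_def matrix_matrix_mult_def sum_3 mat_def mult_exp_exp)

text \<open>The nonzero symbols are, up to symmetry, -m for (1;13), n for (2;23),
  \<open>m * exp (- 2 * m * p $ 3)\<close> for (3;11) and \<open>- n * exp (2 * n * p $ 3)\<close>
  for (3;22), upper index first. The tension field evaluates the target form on the diagonal
  only.\<close>

lemma christoffel_form_sol:
  "christoffel_form (sol_metric m n) p v v $ 1 = - 2 * m * (v $ 1 * v $ 3)"
  "christoffel_form (sol_metric m n) p v v $ 2 = 2 * n * (v $ 2 * v $ 3)"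
  "christoffel_form (sol_metric m n) p v v $ 3 =
     m * exp (- 2 * m * p $ 3) * (v $ 1)\<^sup>2 - n * exp (2 * n * p $ 3) * (v $ 2)\<^sup>2"
proof -
  have s: "sol_metric m n z $ 1 $ 1 = exp ((- 2 * m) * z $ 3)" "sol_metric m n z $ 2 $ 2 = exp ((2 * n) * z $ 3)"
    "sol_metric m n z $ 3 $ 3 = 1"
    "sol_metric m n z $ 1 $ 2 = 0" "sol_metric m n z $ 1 $ 3 = 0" "sol_metric m n z $ 2 $ 1 = 0"
    "sol_metric m n z $ 2 $ 3 = 0" "sol_metric m n z $ 3 $ 1 = 0" "sol_metric m n z $ 3 $ 2 = 0" for z
    by (simp_all add: sol_metric_def)
  have c: "partial i (\<lambda>z. sol_metric m n z $ j $ k) p =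
      (if i = 3 \<and> j = 1 \<and> k = 1 then - 2 * m * exp (- 2 * m * p $ 3)
       else if i = 3 \<and> j = 2 \<and> k = 2 then 2 * n * exp (2 * n * p $ 3) else 0)" for i j k
    using exhaust_3[of j] exhaust_3[of k] partial_exp[of i "- 2 * m" p] partial_exp[of i "2 * n" p]
    by (elim disjE) (simp_all add: s partial_const)
  note c = christoffel_form_def christoffel_def sum_3 c matrix_inv_sol_metric mult_exp_exp
  show "christoffel_form (sol_metric m n) p v v $ 1 = - 2 * m * (v $ 1 * v $ 3)"
    "christoffel_form (sol_metric m n) p v v $ 2 = 2 * n * (v $ 2 * v $ 3)"
    "christoffel_form (sol_metric m n) p v v $ 3 =
     m * exp (- 2 * m * p $ 3) * (v $ 1)\<^sup>2 - n * exp (2 * n * p $ 3) * (v $ 2)\<^sup>2"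
    by (simp_all add: c power2_eq_square mult.assoc[symmetric])
qed

section \<open>Harmonic maps into Sol\<close>

text \<open>The maximum sets of component \<open>j\<close> are open in every chart, hence open. The
  drift field is a hypothesis because its source depends on \<open>j\<close>: a product formula for
  \<open>x\<close> and \<open>y\<close>, the constancy of these two for \<open>t\<close>.\<close>

lemma component_constant:
  fixes M :: "('a, 'n::finite) riemannian" and \<phi> :: "'a \<Rightarrow> real ^ 3"
  assumes M: "riemannian_manifold M" "compact_space (space_of M)" "connected_space (space_of M)"
    and harm: "harmonic_map M (Sol3 m n) \<phi>"
    and drift: "\<And>c S f (E :: 'n \<Rightarrow> real ^ 'n \<Rightarrow> real ^ 'n). c \<in> atlas_of M \<Longrightarrow> S = snd c ` fst c \<Longrightarrow> f = \<phi> \<circ> chart_inv c \<Longrightarrow>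
      open S \<Longrightarrow> smooth_on S f \<Longrightarrow> (\<And>i. continuous_on S (E i)) \<Longrightarrow>
      \<exists>b. continuous_on S b \<and>
        (\<forall>x\<in>S. (\<Sum>i\<in>UNIV. christoffel_form (sol_metric m n) (f x) (frechet_derivative f (at x) (E i x))
          (frechet_derivative f (at x) (E i x))) $ j = frechet_derivative f (at x) (b x) $ j)"
  shows "(\<lambda>y. \<phi> y $ j) constant_on topspace (space_of M)"
proof (rule constant_on_if_open_max_sets[OF M(2,3)])
  have sm: "smooth_map M (Sol3 m n) \<phi>" using harm by (simp add: harmonic_map_def)
  then have "continuous_map (space_of M) euclidean \<phi>" by (simp add: smooth_map_def Sol3_def)
  then show "continuous_map (space_of M) euclidean (\<lambda>y. \<phi> y $ j)"
    using continuous_map_compose[of "space_of M" euclidean \<phi> euclidean "\<lambda>v. v $ j"]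
    by (simp add: o_def continuous_on_component continuous_on_id)
  fix K assume K: "\<And>y. y \<in> topspace (space_of M) \<Longrightarrow> \<phi> y $ j \<le> K"
  have at: "smooth_atlas (space_of M) (atlas_of M)" using M(1) by (simp add: riemannian_manifold_def)
  show "openin (space_of M) {y \<in> topspace (space_of M). \<phi> y $ j = K}"
  proof (rule openin_if_open_in_charts[of "atlas_of M"])
    show "\<Union> (fst ` atlas_of M) = topspace (space_of M)" "\<And>c. c \<in> atlas_of M \<Longrightarrow> chart_on (space_of M) c"
      using at by (auto simp: smooth_atlas_def)
    fix c assume c: "c \<in> atlas_of M"
    define S where "S = snd c ` fst c"
    define g where "g = metric_of M c"
    define f where "f = \<phi> \<circ> chart_inv c"
    have ch: "chart_on (space_of M) c" using at c by (simp add: smooth_atlas_def)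
    have S: "open S" using ch by (simp add: chart_on_def S_def)
    have g: "smooth_on S g" "\<And>x. x \<in> S \<Longrightarrow> transpose (g x) = g x"
      "\<And>x v. x \<in> S \<Longrightarrow> v \<noteq> 0 \<Longrightarrow> v \<bullet> (g x *v v) > 0"
      using M(1) c by (auto simp: riemannian_manifold_def g_def S_def)
    \<comment> \<open>\<open>Sol3\<close> has the single chart \<open>(UNIV, id)\<close>, so the
      local representative lives on the whole image of \<open>c\<close>.\<close>
    have loc: "local_dom c (UNIV, id) \<phi> = S" "local_rep c (UNIV, id) \<phi> = f"
      by (auto simp: local_dom_def local_rep_def S_def f_def)
    have f: "smooth_on S f"
      using sm c by (auto simp: smooth_map_def Sol3_def loc)
    obtain E where E: "orthonormal_frame g S E"
      using gram_schmidt_smooth[OF S g, of UNIV] by (auto simp: orthonormal_frame_def)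
    have tau: "tension g (sol_metric m n) f E x = 0" if "x \<in> S" for x
    proof -
      have "\<forall>V E. open V \<and> V \<subseteq> S \<and> orthonormal_frame g V E \<longrightarrow>
          (\<forall>x\<in>V. tension g (sol_metric m n) f E x = 0)"
        using bspec[OF conjunct2[OF harm[unfolded harmonic_map_def]] c]
        by (simp add: Sol3_def loc g_def)
      with S E that show ?thesis by blast
    qed
    have cE: "continuous_on S (E i)" for i
      using E by (simp add: orthonormal_frame_def smooth_on_continuous)
    obtain b where b: "continuous_on S b"
      "\<And>x. x \<in> S \<Longrightarrow> (\<Sum>i\<in>UNIV. christoffel_form (sol_metric m n) (f x) (frechet_derivative f (at x) (E i x))
          (frechet_derivative f (at x) (E i x))) $ j = frechet_derivative f (at x) (b x) $ j"
      using drift[of c S f E, OF c S_def f_def S f cE] by blast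
    have le: "f x $ j \<le> K" if "x \<in> S" for x
    proof -
      have "chart_inv c x \<in> fst c" using that unfolding S_def chart_inv_def by (rule inv_into_into)
      then show ?thesis using K at c by (auto simp: f_def smooth_atlas_def)
    qed
    have "open {x \<in> S. f x $ j = K}"
      by (rule open_max_set_component[OF S g(1) f E tau b le])
    then show "open {z \<in> snd c ` fst c. \<phi> (chart_inv c z) $ j = K}"
      by (simp add: S_def f_def)
  qed
qed

text \<open>Component \<open>j\<close> of \<open>f\<close> is constant on the open set
  \<open>S\<close>. This removes the squares from the equation for \<open>t\<close>.\<close>

lemma frechet_derivative_component_zero:
  assumes M: "smooth_atlas X A" and c: "c \<in> A" "S = snd c ` fst c" "f = \<phi> \<circ> chart_inv c"
    and S: "open S" "smooth_on S f" and x: "x \<in> S"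
    and const: "(\<lambda>y. \<phi> y $ j) constant_on topspace X"
  shows "frechet_derivative f (at x) v $ j = 0"
proof -
  obtain k where k: "\<And>y. y \<in> topspace X \<Longrightarrow> \<phi> y $ j = k"
    using const by (auto simp: constant_on_def)
  have "f z $ j = k" if "z \<in> S" for z
  proof -
    have "chart_inv c z \<in> fst c" using that unfolding c chart_inv_def by (rule inv_into_into)
    then show ?thesis using k M c by (auto simp: smooth_atlas_def)
  qed
  then have "((\<lambda>z. f z $ j) has_derivative (\<lambda>v. 0)) (at x)"
    by (intro has_derivative_transform_within_open[OF has_derivative_const S(1) x]) simp
  moreover have "((\<lambda>z. f z $ j) has_derivative (\<lambda>v. frechet_derivative f (at x) v $ j)) (at x)"
    by (intro bounded_linear.has_derivative[OF bounded_linear_vec_nth] smooth_on_differentiable[OF S(2) x])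
  ultimately show ?thesis by (metis has_derivative_unique)
qed

lemma continuous_on_frechet_derivative:
  fixes e :: "real ^ 'n::finite \<Rightarrow> real ^ 'n"
  assumes "smooth_on S f" "continuous_on S e"
  shows "continuous_on S (\<lambda>x. frechet_derivative f (at x) (e x))"
proof -
  have "continuous_on S (\<lambda>x. \<Sum>k\<in>UNIV. e x $ k *\<^sub>R partial k f x)"
    by (intro continuous_intros assms(2) smooth_on_continuous smooth_on_partial assms(1))
  then show ?thesis
    by (rule continuous_on_eq) (simp add: frechet_derivative_partial[OF assms(1)])
qed

text \<open>Since \<open>df\<close> is linear, a product of components \<open>j\<close> and
  \<open>l\<close> of \<open>df (E i)\<close> is component \<open>j\<close> of \<open>df\<close>
  applied to a multiple of \<open>E i\<close>. For an orthonormal frame the resulting field is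
  \<open>a\<close> times the gradient of component \<open>l\<close>.\<close>

lemma product_drift:
  fixes f :: "real ^ 'n::finite \<Rightarrow> real ^ 'k::finite"
  assumes f: "smooth_on S f" and E: "\<And>i. continuous_on S (E i)"
    and eq: "\<And>x w. christoffel_form h (f x) w w $ j = a * (w $ j * w $ l)"
  shows "\<exists>b. continuous_on S b \<and>
        (\<forall>x\<in>S. (\<Sum>i\<in>UNIV. christoffel_form h (f x) (frechet_derivative f (at x) (E i x))
          (frechet_derivative f (at x) (E i x))) $ j = frechet_derivative f (at x) (b x) $ j)"
proof (intro exI[of _ "\<lambda>x. \<Sum>i\<in>UNIV. (a * frechet_derivative f (at x) (E i x) $ l) *\<^sub>R E i x"] conjI ballI)
  show "continuous_on S (\<lambda>x. \<Sum>i\<in>UNIV. (a * frechet_derivative f (at x) (E i x) $ l) *\<^sub>R E i x)"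
    by (intro continuous_intros continuous_on_frechet_derivative f E)
  fix x assume "x \<in> S"
  then have l: "linear (frechet_derivative f (at x))"
    using smooth_on_differentiable[OF f] has_derivative_linear by blast
  show "(\<Sum>i\<in>UNIV. christoffel_form h (f x) (frechet_derivative f (at x) (E i x))
      (frechet_derivative f (at x) (E i x))) $ j =
    frechet_derivative f (at x) (\<Sum>i\<in>UNIV. (a * frechet_derivative f (at x) (E i x) $ l) *\<^sub>R E i x) $ j"
    by (simp add: eq linear_sum[OF l] linear_scale[OF l] mult_ac)
qed

theorem theorem4:
  fixes M :: "('a, 'n::finite) riemannian"
    and m n :: real
    and \<phi> :: "'a \<Rightarrow> real ^ 3"
  assumes "m > 0" and "n > 0"
    and "riemannian_manifold M"
    and "compact_space (space_of M)"
    and "connected_space (space_of M)"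
    and "orientable M"
    and "harmonic_map M (Sol3 m n) \<phi>"
  shows "\<phi> constant_on topspace (space_of M)"
proof -
  note const = component_constant[OF assms(3-5,7)]
  \<comment> \<open>The quadratic terms for \<open>x\<close> and \<open>y\<close> are products with
    the derivative of \<open>t\<close>, whence \<open>l = 3\<close> in both cases.\<close>
  have 1: "(\<lambda>y. \<phi> y $ 1) constant_on topspace (space_of M)"
    by (rule const, rule product_drift[where l = 3, OF _ _ christoffel_form_sol(1)])
  have 2: "(\<lambda>y. \<phi> y $ 2) constant_on topspace (space_of M)"
    by (rule const, rule product_drift[where l = 3, OF _ _ christoffel_form_sol(2)])
  have at: "smooth_atlas (space_of M) (atlas_of M)" using assms(3) by (simp add: riemannian_manifold_def)
  \<comment> \<open>The quadratic term for \<open>t\<close> involves only derivatives of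
    \<open>x\<close> and \<open>y\<close>, which now vanish, so the zero drift works.\<close>
  have 3: "(\<lambda>y. \<phi> y $ 3) constant_on topspace (space_of M)"
  proof (rule const, intro exI[of _ "\<lambda>_. 0"] conjI ballI continuous_on_const)
    fix c S f and E :: "'n \<Rightarrow> real ^ 'n \<Rightarrow> real ^ 'n" and x
    assume c: "c \<in> atlas_of M" "S = snd c ` fst c" "f = \<phi> \<circ> chart_inv c" "open S" "smooth_on S f"
      and x: "x \<in> S"
    have "frechet_derivative f (at x) v $ 1 = 0" "frechet_derivative f (at x) v $ 2 = 0" for v
      using frechet_derivative_component_zero[OF at c x] 1 2 by blast+
    moreover have "linear (frechet_derivative f (at x))"
      using smooth_on_differentiable[OF c(5) x] has_derivative_linear by blast
    ultimately show "(\<Sum>i\<in>UNIV. christoffel_form (sol_metric m n) (f x) (frechet_derivative f (at x) (E i x))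
        (frechet_derivative f (at x) (E i x))) $ 3 = frechet_derivative f (at x) 0 $ 3"
      by (simp add: christoffel_form_sol linear_0)
  qed
  show ?thesis
    using 1 2 3 unfolding constant_on_def vec_eq_iff forall_3
    by (metis (mono_tags))
qed

end
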